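(* Let $c\in\mathbb{R}$ be a constant. The differential equation $y'=c$ on $\mathbb{R}^2$ admits a 5-dimensional Lie subgroup of $A(2,\mathbb{R})$, and it can be transformed to the equation $y'=0$ by an element of $A(2,\mathbb{R})$.
   Context: $A(2,\mathbb{R})$ is the group of invertible affine transformations of $\mathbb{R}^2$ (a 6-dimensional Lie group). An equation $y'=f(x,y)$ with $f$ smooth on a connected open set $U\subset\mathbb{R}^2$ is identified with the Pfaffian system $\langle dy-f\,dx\rangle$, i.e. with the line field $\ell_f(p)=\ker(dy-f\,dx)_p$, $p\in U$. The equation $y'=f$ admits a Lie subgroup $H\subset A(2,\mathbb{R})$ if $dh_p(\ell_f(p))=\ell_f(h(p))$ for all $h\in H$ and all $p\in U$ with $h(p)\in U$. The equation $y'=f$ on $U$ can be transformed to $y'=F$ on $U'$ by an element of $A(2,\mathbb{R})$ if for each $p\in U$ there are a neighbourhood $V\subset U$ of $p$ and $g\in A(2,\mathbb{R})$ with $g(V)\subset U'$ and $dg_q(\ell_f(q))=\ell_F(g(q))$ for all $q\in V$. *)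

theory Defs
  imports "HOL-Analysis.Analysis" "HOL-Algebra.Group"
begin

text \<open>Differentiability classes on an open set, through iterated directional derivatives.\<close>

primrec Ck_on :: "nat \<Rightarrow> 'a::euclidean_space set \<Rightarrow> ('a \<Rightarrow> 'b::real_normed_vector) \<Rightarrow> bool" where
  "Ck_on 0 S f \<longleftrightarrow> continuous_on S f"
| "Ck_on (Suc k) S f \<longleftrightarrow>
     (\<forall>x\<in>S. f differentiable (at x)) \<and> (\<forall>v. Ck_on k S (\<lambda>x. frechet_derivative f (at x) v))"

definition smooth_on :: "'a::euclidean_space set \<Rightarrow> ('a \<Rightarrow> 'b::real_normed_vector) \<Rightarrow> bool" where
  "smooth_on S f \<longleftrightarrow> (\<forall>k. Ck_on k S f)"

text \<open>
  An atlas is a set of pairs \<open>(U, \<phi>)\<close> of an open set \<open>U\<close> of the model space \<open>'d\<close> and a local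
  parametrization \<open>\<phi>\<close>, i.e. the inverse of a chart, of which only the restriction to \<open>U\<close> matters.
  The dimension of the manifold is \<open>DIM('d)\<close>.
\<close>

type_synonym ('d, 'a) atlas = "('d set \<times> ('d \<Rightarrow> 'a)) set"

definition smooth_manifold :: "'a topology \<Rightarrow> ('d::euclidean_space, 'a) atlas \<Rightarrow> bool" where
  "smooth_manifold X A \<longleftrightarrow>
     Hausdorff_space X \<and> second_countable X \<and>
     topspace X = (\<Union>(U, \<phi>)\<in>A. \<phi> ` U) \<and>
     (\<forall>(U, \<phi>)\<in>A. open U \<and> openin X (\<phi> ` U) \<and>
        homeomorphic_map (top_of_set U) (subtopology X (\<phi> ` U)) \<phi>) \<and>
     (\<forall>(U, \<phi>)\<in>A. \<forall>(V, \<psi>)\<in>A. smooth_on {u\<in>U. \<phi> u \<in> \<psi> ` V} (\<lambda>u. inv_into V \<psi> (\<phi> u)))"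

text \<open>Continuity makes the domains of the coordinate expressions open.\<close>

definition smooth_map ::
  "'a topology \<Rightarrow> ('d::euclidean_space, 'a) atlas \<Rightarrow>
   'b topology \<Rightarrow> ('e::euclidean_space, 'b) atlas \<Rightarrow> ('a \<Rightarrow> 'b) \<Rightarrow> bool" where
  "smooth_map X A Y B g \<longleftrightarrow>
     continuous_map X Y g \<and>
     (\<forall>(U, \<phi>)\<in>A. \<forall>(V, \<psi>)\<in>B.
        smooth_on {u\<in>U. g (\<phi> u) \<in> \<psi> ` V} (\<lambda>u. inv_into V \<psi> (g (\<phi> u))))"

definition prod_atlas :: "('d, 'a) atlas \<Rightarrow> ('e, 'b) atlas \<Rightarrow> ('d \<times> 'e, 'a \<times> 'b) atlas" where
  "prod_atlas A B = {(U \<times> V, map_prod \<phi> \<psi>) |U \<phi> V \<psi>. (U, \<phi>) \<in> A \<and> (V, \<psi>) \<in> B}"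

definition lie_group ::
  "'a monoid \<Rightarrow> 'a topology \<Rightarrow> ('d::euclidean_space, 'a) atlas \<Rightarrow> bool" where
  "lie_group G X A \<longleftrightarrow>
     group G \<and> topspace X = carrier G \<and> smooth_manifold X A \<and>
     smooth_map (prod_topology X X) (prod_atlas A A) X A (\<lambda>(x, y). x \<otimes>\<^bsub>G\<^esub> y) \<and>
     smooth_map X A X A (\<lambda>x. inv\<^bsub>G\<^esub> x)"

text \<open>
  The pair \<open>(M, b)\<close> stands for the affine map sending \<open>x\<close> to \<open>M x + b\<close>.
\<close>

type_synonym aff2 = "(real^2^2) \<times> (real^2)"

definition aff :: "aff2 \<Rightarrow> real^2 \<Rightarrow> real^2" where
  "aff g x = fst g *v x + snd g"

definition A2 :: "aff2 monoid" where
  "A2 = \<lparr>carrier = {g. invertible (fst g)},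
         mult = (\<lambda>g h. (fst g ** fst h, fst g *v snd h + snd g)),
         one = (mat 1, 0)\<rparr>"

lemma aff_mult: "aff (g \<otimes>\<^bsub>A2\<^esub> h) = aff g \<circ> aff h"
  by (simp add: A2_def aff_def fun_eq_iff matrix_vector_mul_assoc matrix_vector_right_distrib)

lemma aff_inject: "aff g = aff h \<longleftrightarrow> g = h"
proof
  assume eq: "aff g = aff h"
  then have "snd g = snd h"
    by (metis add_0 aff_def matrix_vector_mult_0_right)
  moreover from this eq have "fst g = fst h"
    by (metis add_right_cancel aff_def matrix_eq)
  ultimately show "g = h"
    by (simp add: prod_eq_iff)
qed simp

lemma group_A2: "group A2"
proof (rule groupI)
  fix g assume "g \<in> carrier A2"
  then obtain N where N: "N ** fst g = mat 1" "fst g ** N = mat 1"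
    by (auto simp: A2_def invertible_def)
  have "(N, - (N *v snd g)) \<in> carrier A2" "(N, - (N *v snd g)) \<otimes>\<^bsub>A2\<^esub> g = \<one>\<^bsub>A2\<^esub>"
    using N by (auto simp: A2_def invertible_def)
  then show "\<exists>h\<in>carrier A2. h \<otimes>\<^bsub>A2\<^esub> g = \<one>\<^bsub>A2\<^esub>" ..
next
  show "\<one>\<^bsub>A2\<^esub> \<in> carrier A2"
    by (auto simp: A2_def invertible_def intro: exI[of _ "mat 1"])
qed (simp_all add: A2_def invertible_mult matrix_mul_assoc matrix_vector_mul_assoc
      matrix_vector_right_distrib add.assoc)

text \<open>
  A Lie subgroup of \<open>A2\<close>, of dimension \<open>DIM('d)\<close>: a subgroup with a topology (possibly finer than
  the induced one) and a smooth structure making it a Lie group and an immersed submanifold.  The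
  carrier of \<open>A2\<close> is open in its ambient six-dimensional Euclidean space and carries the induced
  smooth structure, so the coordinate expressions of the inclusion are the parametrizations.
\<close>

definition lie_subgroup_A2 :: "'d::euclidean_space itself \<Rightarrow> aff2 set \<Rightarrow> bool" where
  "lie_subgroup_A2 (_ :: 'd itself) H \<longleftrightarrow>
     subgroup H A2 \<and>
     (\<exists>X (A :: ('d, aff2) atlas).
        lie_group (A2\<lparr>carrier := H\<rparr>) X A \<and>
        (\<forall>(U, \<phi>)\<in>A. smooth_on U \<phi> \<and> (\<forall>u\<in>U. inj (frechet_derivative \<phi> (at u)))))"

text \<open>
  The coordinates are \<open>x = p $ 1\<close> and \<open>y = p $ 2\<close>; the line field of \<open>y' = f(x, y)\<close> is the kernel of
  \<open>dy - f dx\<close>.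
\<close>

definition line_field :: "(real^2 \<Rightarrow> real) \<Rightarrow> real^2 \<Rightarrow> (real^2) set" where
  "line_field f p = {v. v $ 2 - f p * v $ 1 = 0}"

definition admits :: "(real^2) set \<Rightarrow> (real^2 \<Rightarrow> real) \<Rightarrow> aff2 set \<Rightarrow> bool" where
  "admits U f H \<longleftrightarrow>
     (\<forall>h\<in>H. \<forall>p\<in>U. aff h p \<in> U \<longrightarrow>
        frechet_derivative (aff h) (at p) ` line_field f p = line_field f (aff h p))"

definition transformable ::
  "(real^2) set \<Rightarrow> (real^2 \<Rightarrow> real) \<Rightarrow> (real^2) set \<Rightarrow> (real^2 \<Rightarrow> real) \<Rightarrow> bool" where
  "transformable U f U' F \<longleftrightarrow>
     (\<forall>p\<in>U. \<exists>V. open V \<and> p \<in> V \<and> V \<subseteq> U \<and>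
        (\<exists>g\<in>carrier A2. aff g ` V \<subseteq> U' \<and>
           (\<forall>q\<in>V. frechet_derivative (aff g) (at q) ` line_field f q = line_field F (aff g q))))"

end

theory Submission
  imports Defs
begin

text \<open>
  The affine maps whose linear part has \<open>(1, c)\<close> as an eigenvector preserve the constant line field
  of \<open>y' = c\<close>.  The shear \<open>(x, y) \<mapsto> (x, y - c x)\<close> carries \<open>y' = c\<close> to \<open>y' = 0\<close> and conjugates
  this stabilizer to the one for \<open>c = 0\<close>, the affine maps with upper triangular linear part.  The
  five entries of such a map are a global chart, in which multiplication is polynomial and inversion
  is rational with denominators that do not vanish.
\<close>

section \<open>Calculus of smooth maps\<close>

lemma frechet_derivative_eq:
  "(f has_derivative f') (at x) \<Longrightarrow> frechet_derivative f (at x) = f'"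
  by (metis frechet_derivative_at)

text \<open>Derivatives are taken at points of the whole space, so openness of \<open>S\<close> is
  what makes them depend only on the values in \<open>S\<close>. The induction then passes to
  directional derivatives, hence \<open>f\<close> and \<open>g\<close> vary.\<close>

lemma Ck_on_cong:
  assumes "open S" "\<And>x. x \<in> S \<Longrightarrow> f x = g x" "Ck_on k S f"
  shows "Ck_on k S g"
  using assms(2,3)
proof (induction k arbitrary: f g)
  case 0
  then show ?case by (simp cong: continuous_on_cong)
next
  case (Suc k)
  have der: "(g has_derivative frechet_derivative f (at x)) (at x)" if "x \<in> S" for x
    using that Suc.prems assms(1)
    by (intro has_derivative_transform_within_open[of f _ x UNIV S g])
       (auto simp: frechet_derivative_works[THEN iffD1])
  have "Ck_on k S (\<lambda>x. frechet_derivative g (at x) v)" for v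
    by (rule Suc.IH[of "\<lambda>x. frechet_derivative f (at x) v"])
       (use Suc.prems in \<open>auto simp: frechet_derivative_eq[OF der]\<close>)
  then show ?case
    using der by (auto simp: differentiable_def)
qed

text \<open>Trades the choice-based \<open>frechet_derivative\<close> for an explicit derivative
  \<open>f'\<close>, so that each differentiation rule yields a closure rule for
  \<open>Ck_on\<close>.\<close>

lemma Ck_on_SucI:
  assumes "open S" "\<And>x. x \<in> S \<Longrightarrow> (f has_derivative f' x) (at x)"
    and "\<And>v. Ck_on k S (\<lambda>x. f' x v)"
  shows "Ck_on (Suc k) S f"
proof -
  have "Ck_on k S (\<lambda>x. frechet_derivative f (at x) v)" for v
    by (rule Ck_on_cong[OF assms(1) _ assms(3)[of v]]) (simp add: frechet_derivative_eq[OF assms(2)])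
  then show ?thesis
    using assms(2) by (auto simp: differentiable_def)
qed

lemma Ck_on_SucD:
  "Ck_on (Suc k) S f \<Longrightarrow> Ck_on k S f"
proof (induction k arbitrary: f)
  case 0
  then show ?case
    by (auto intro!: differentiable_imp_continuous_on simp: differentiable_on_def
        differentiable_at_withinI)
next
  case (Suc k)
  show ?case
    unfolding Ck_on.simps(2)[of k]
    using Suc.prems Suc.IH[of "\<lambda>x. frechet_derivative f (at x) _"]
    unfolding Ck_on.simps(2)[of "Suc k"] by blast
qed

lemma Ck_on_has_derivative:
  "Ck_on (Suc k) S f \<Longrightarrow> x \<in> S \<Longrightarrow> (f has_derivative frechet_derivative f (at x)) (at x)"
  by (simp add: frechet_derivative_works[THEN iffD1])

lemma Ck_on_frechet_derivative:
  "Ck_on (Suc k) S f \<Longrightarrow> Ck_on k S (\<lambda>x. frechet_derivative f (at x) v)"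
  by simp

lemma Ck_on_const: "open S \<Longrightarrow> Ck_on k S (\<lambda>x. a)"
proof (induction k arbitrary: a)
  case (Suc k)
  show ?case
    by (rule Ck_on_SucI[where f' = "\<lambda>_ _. 0"]) (use Suc in auto)
qed simp

text \<open>A bounded linear map is its own derivative at every point, so its directional
  derivatives are constant.\<close>

lemma smooth_on_bounded_linear:
  assumes "bounded_linear f" "open S"
  shows "smooth_on S f"
proof -
  have "Ck_on k S f" for k
  proof (cases k)
    case 0
    then show ?thesis
      using assms by (simp add: linear_continuous_on)
  next
    case (Suc k)
    have "Ck_on (Suc k) S f"
      by (rule Ck_on_SucI[where f' = "\<lambda>_. f"])
         (use assms in \<open>auto simp: bounded_linear_imp_has_derivative Ck_on_const\<close>)
    then show ?thesis
      using Suc by simp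
  qed
  then show ?thesis
    by (simp add: smooth_on_def)
qed

lemma Ck_on_add:
  assumes "open S" "Ck_on k S f" "Ck_on k S g"
  shows "Ck_on k S (\<lambda>x. f x + g x)"
  using assms(2,3)
proof (induction k arbitrary: f g)
  case 0
  then show ?case by (simp add: continuous_on_add)
next
  case (Suc k)
  show ?case
    by (rule Ck_on_SucI[OF assms(1) has_derivative_add[OF
          Ck_on_has_derivative[OF Suc.prems(1)] Ck_on_has_derivative[OF Suc.prems(2)]]])
       (use Suc in auto)
qed

text \<open>By the Leibniz rule a directional derivative is a sum of two products, each pairing one
  factor with a derivative of the other; \<open>Ck_on_SucD\<close> lowers the class of the
  undifferentiated factor. Real products and scaling of vectors are both instances.\<close>

lemma (in bounded_bilinear) Ck_on:
  assumes "open S" "Ck_on k S f" "Ck_on k S g"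
  shows "Ck_on k S (\<lambda>x. prod (f x) (g x))"
  using assms(2,3)
proof (induction k arbitrary: f g)
  case 0
  then show ?case by (simp add: continuous_on)
next
  case (Suc k)
  show ?case
    by (rule Ck_on_SucI[OF assms(1) FDERIV[OF
          Ck_on_has_derivative[OF Suc.prems(1)] Ck_on_has_derivative[OF Suc.prems(2)]]])
       (intro Ck_on_add assms(1) Suc.IH Ck_on_frechet_derivative Suc.prems Suc.prems[THEN Ck_on_SucD]
         | assumption)+
qed

lemma Ck_on_inverse:
  fixes f :: "'a::euclidean_space \<Rightarrow> real"
  assumes "open S" "Ck_on k S f" "\<And>x. x \<in> S \<Longrightarrow> f x \<noteq> 0"
  shows "Ck_on k S (\<lambda>x. inverse (f x))"
  using assms(2,3)
proof (induction k)
  case 0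
  then show ?case by (simp add: continuous_on_inverse)
next
  case (Suc k)
  have inv: "Ck_on k S (\<lambda>x. inverse (f x))"
    using Suc Ck_on_SucD by blast
  \<comment> \<open>This is the derivative of \<open>1/f\<close> in direction \<open>v\<close>; the
    induction hypothesis covers the factors \<open>inverse (f x)\<close>, and the sign is a constant
    factor so that the product rule handles it too.\<close>
  have "Ck_on k S (\<lambda>x. (- 1) * (inverse (f x) * frechet_derivative f (at x) v * inverse (f x)))" for v
    using Suc.prems inv assms(1)
    by (intro bounded_bilinear.Ck_on[OF bounded_bilinear_mult] Ck_on_const) auto
  then show ?case
    by (intro Ck_on_SucI[OF assms(1) Deriv.has_derivative_inverse[OF _
          Ck_on_has_derivative[OF Suc.prems(1)]]]) (use Suc.prems in auto)
qed

context
  fixes S :: "'a::euclidean_space set"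
  assumes S: "open S"
begin

lemma smooth_on_const: "smooth_on S (\<lambda>x. a)"
  by (simp add: smooth_on_def Ck_on_const S)

lemma smooth_on_add:
  "smooth_on S f \<Longrightarrow> smooth_on S g \<Longrightarrow> smooth_on S (\<lambda>x. f x + g x)"
  by (simp add: smooth_on_def Ck_on_add S)

lemma smooth_on_mult:
  fixes f g :: "'a \<Rightarrow> real"
  shows "smooth_on S f \<Longrightarrow> smooth_on S g \<Longrightarrow> smooth_on S (\<lambda>x. f x * g x)"
  by (simp add: smooth_on_def bounded_bilinear.Ck_on[OF bounded_bilinear_mult] S)

lemma smooth_on_minus:
  fixes f :: "'a \<Rightarrow> real"
  shows "smooth_on S f \<Longrightarrow> smooth_on S (\<lambda>x. - f x)"
  using smooth_on_mult[OF smooth_on_const[of "- 1"]] by simp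

lemma smooth_on_diff:
  fixes f g :: "'a \<Rightarrow> real"
  shows "smooth_on S f \<Longrightarrow> smooth_on S g \<Longrightarrow> smooth_on S (\<lambda>x. f x - g x)"
  using smooth_on_add[OF _ smooth_on_minus] by simp

lemma smooth_on_inverse:
  fixes f :: "'a \<Rightarrow> real"
  shows "smooth_on S f \<Longrightarrow> (\<And>x. x \<in> S \<Longrightarrow> f x \<noteq> 0) \<Longrightarrow> smooth_on S (\<lambda>x. inverse (f x))"
  by (simp add: smooth_on_def Ck_on_inverse S)

lemma smooth_on_cong:
  "smooth_on S f \<Longrightarrow> (\<And>x. x \<in> S \<Longrightarrow> f x = g x) \<Longrightarrow> smooth_on S g"
  unfolding smooth_on_def using Ck_on_cong[OF S] by blast

text \<open>Expanding in the standard basis gives a finite sum of smooth scalars times constant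
  vectors.\<close>

lemma smooth_on_vec:
  fixes f :: "'a \<Rightarrow> real^'n"
  assumes "\<And>i. smooth_on S (\<lambda>x. f x $ i)"
  shows "smooth_on S f"
proof -
  have "smooth_on S (\<lambda>x. \<Sum>i\<in>I. (f x $ i) *\<^sub>R axis i (1::real))" if "finite I" for I
    using that
  proof induction
    case (insert i I)
    have "smooth_on S (\<lambda>x. (f x $ i) *\<^sub>R axis i (1::real))"
      using assms[of i] smooth_on_const[of "axis i 1"]
      unfolding smooth_on_def using bounded_bilinear.Ck_on[OF bounded_bilinear_scaleR S] by blast
    with insert show ?case
      by (simp add: smooth_on_add)
  qed (simp add: smooth_on_const)
  from this[of UNIV] show ?thesis
    by (simp add: basis_expansion scalar_mult_eq_scaleR[symmetric])
qed

end

section \<open>Lie groups with a global chart\<close>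

text \<open>One chart covers the group, so the only transition map is the identity and the
  smoothness conditions reduce to \<open>mult\<close> and \<open>m_inv\<close>. The explicit inverse
  \<open>\<psi>\<close> stands in for \<open>inv_into U \<phi>\<close>.\<close>

lemma lie_group_global_chart:
  fixes \<phi> :: "'d::euclidean_space \<Rightarrow> 'a::euclidean_space"
  assumes G: "group G" and carrier: "carrier G = \<phi> ` U" and U: "open U"
    and cont: "continuous_on U \<phi>" "continuous_on (\<phi> ` U) \<psi>"
    and inv: "\<And>u. u \<in> U \<Longrightarrow> \<psi> (\<phi> u) = u"
    and mult: "smooth_on (U \<times> U) (\<lambda>(u, v). \<psi> (\<phi> u \<otimes>\<^bsub>G\<^esub> \<phi> v))"
    and m_inv: "smooth_on U (\<lambda>u. \<psi> (inv\<^bsub>G\<^esub> \<phi> u))"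
  shows "lie_group G (top_of_set (carrier G)) {(U, \<phi>)}"
proof -
  interpret group G by fact
  have inj: "inj_on \<phi> U"
    by (metis inj_onI inv)
  have inv_into: "inv_into U \<phi> g = \<psi> g" if "g \<in> carrier G" for g
    using that carrier inv inv_into_f_f[OF inj] by auto
  have \<phi>\<psi>: "\<phi> (\<psi> g) = g" "\<psi> g \<in> U" if "g \<in> carrier G" for g
    using that carrier inv by auto
  have memb: "\<phi> u \<in> carrier G" if "u \<in> U" for u
    using that carrier by auto
  have "homeomorphic_maps (top_of_set U) (top_of_set (carrier G)) \<phi> \<psi>"
    using cont inv carrier by (auto simp: homeomorphic_maps_def)
  then have homeo: "homeomorphic_map (top_of_set U) (top_of_set (carrier G)) \<phi>"
    using homeomorphic_map_maps by blast
  have sc: "second_countable (top_of_set (carrier G))"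
  proof (rule second_countable_subtopology)
    obtain \<B> :: "'a set set" where "countable \<B>" "\<And>C. C \<in> \<B> \<Longrightarrow> open C"
      "\<And>S. open S \<Longrightarrow> \<exists>\<U>. \<U> \<subseteq> \<B> \<and> S = \<Union>\<U>"
      using univ_second_countable by blast
    then show "second_countable (euclidean :: 'a topology)"
      unfolding second_countable_def by (intro exI[of _ \<B>]) (fastforce simp: subset_iff)
  qed
  have trans: "smooth_on U (\<lambda>u. inv_into U \<phi> (\<phi> u))"
    using smooth_on_bounded_linear[OF bounded_linear_ident U]
    by (rule smooth_on_cong[OF U]) (simp add: inj)
  \<comment> \<open>Continuity of the group operations comes from the case \<open>k = 0\<close> of
    smoothness in coordinates: conjugating the coordinate expression by \<open>\<phi>\<close> and
    \<open>\<psi>\<close> returns the operation itself.\<close>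
  have "continuous_on (U \<times> U) (\<lambda>(u, v). \<psi> (\<phi> u \<otimes>\<^bsub>G\<^esub> \<phi> v))"
    using mult unfolding smooth_on_def by (metis Ck_on.simps(1))
  from continuous_on_compose2[OF cont(1)
      continuous_on_compose2[OF this, of "carrier G \<times> carrier G" "map_prod \<psi> \<psi>"]]
  have "continuous_on (carrier G \<times> carrier G) (\<lambda>z. \<phi> (\<psi> (\<phi> (\<psi> (fst z)) \<otimes>\<^bsub>G\<^esub> \<phi> (\<psi> (snd z)))))"
    using cont(2) \<phi>\<psi>
    by (force simp: map_prod_def case_prod_beta carrier[symmetric]
        intro!: continuous_on_Pair continuous_on_compose2[OF cont(2)] continuous_intros)
  then have cmult: "continuous_on (carrier G \<times> carrier G) (\<lambda>(x, y). x \<otimes>\<^bsub>G\<^esub> y)"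
    by (rule continuous_on_eq) (auto simp: \<phi>\<psi>)
  have "continuous_on U (\<lambda>u. \<psi> (inv\<^bsub>G\<^esub> \<phi> u))"
    using m_inv unfolding smooth_on_def by (metis Ck_on.simps(1))
  from continuous_on_compose2[OF cont(1) continuous_on_compose2[OF this cont(2)]]
  have "continuous_on (carrier G) (\<lambda>z. \<phi> (\<psi> (inv\<^bsub>G\<^esub> (\<phi> (\<psi> z)))))"
    using \<phi>\<psi> by (force simp: carrier[symmetric])
  then have cinv: "continuous_on (carrier G) (\<lambda>x. inv\<^bsub>G\<^esub> x)"
    by (rule continuous_on_eq) (auto simp: \<phi>\<psi>)
  have UU: "open (U \<times> U)"
    using U by (simp add: open_Times)
  \<comment> \<open>The coordinate expressions are defined everywhere, because the chart covers a
    set closed under the group operations.\<close>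
  have dom_id: "{u \<in> U. \<phi> u \<in> \<phi> ` U} = U"
    by auto
  have dom_mult: "{u \<in> U \<times> U. (case map_prod \<phi> \<phi> u of (x, y) \<Rightarrow> x \<otimes>\<^bsub>G\<^esub> y) \<in> \<phi> ` U} = U \<times> U"
    using memb by (auto simp: carrier[symmetric])
  have dom_inv: "{u \<in> U. inv\<^bsub>G\<^esub> (\<phi> u) \<in> \<phi> ` U} = U"
    using memb by (auto simp: carrier[symmetric])
  have smult: "smooth_on (U \<times> U)
      (\<lambda>u. inv_into U \<phi> (case map_prod \<phi> \<phi> u of (x, y) \<Rightarrow> x \<otimes>\<^bsub>G\<^esub> y))"
    by (rule smooth_on_cong[OF UU mult]) (auto simp: inv_into memb)
  have sinv: "smooth_on U (\<lambda>u. inv_into U \<phi> (inv\<^bsub>G\<^esub> (\<phi> u)))"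
    by (rule smooth_on_cong[OF U m_inv]) (auto simp: inv_into memb)
  have pa: "prod_atlas {(U, \<phi>)} {(U, \<phi>)} = {(U \<times> U, map_prod \<phi> \<phi>)}"
    by (auto simp: prod_atlas_def)
  show ?thesis
    unfolding lie_group_def smooth_manifold_def smooth_map_def pa
    using G homeo sc trans cmult cinv dom_id dom_mult dom_inv smult sinv U
    by (auto simp: carrier[symmetric] Hausdorff_space_subtopology subtopology_subtopology)
qed

section \<open>The stabilizer of a direction\<close>

lemma exhaust_5:
  fixes x :: 5
  shows "x = 1 \<or> x = 2 \<or> x = 3 \<or> x = 4 \<or> x = 5"
proof (induct x)
  case (of_int z)
  \<comment> \<open>The index type is the integers modulo 5, so the representative 0 is the index
    5.\<close>
  then have "z = 0 \<or> z = 1 \<or> z = 2 \<or> z = 3 \<or> z = 4" by fastforce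
  then show ?case by auto
qed

lemma forall_5: "(\<forall>i::5. P i) \<longleftrightarrow> P 1 \<and> P 2 \<and> P 3 \<and> P 4 \<and> P 5"
  by (metis exhaust_5)

definition vec5 :: "real \<Rightarrow> real \<Rightarrow> real \<Rightarrow> real \<Rightarrow> real \<Rightarrow> real^5" where
  "vec5 a b d e f = (\<chi> i. if i = 1 then a else if i = 2 then b else if i = 3 then d
     else if i = 4 then e else f)"

lemma vec5_nth [simp]:
  "vec5 a b d e f $ 1 = a" "vec5 a b d e f $ 2 = b" "vec5 a b d e f $ 3 = d"
  "vec5 a b d e f $ 4 = e" "vec5 a b d e f $ 5 = f"
  by (simp_all add: vec5_def)

text \<open>
  With \<open>S\<close> the shear \<open>(x, y) \<mapsto> (x, y + c x)\<close>, this is the conjugate by \<open>S\<close> of the affine map with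
  upper triangular linear part \<open>(u\<^sub>1, u\<^sub>2; 0, u\<^sub>3)\<close> and translation part \<open>(u\<^sub>4, u\<^sub>5)\<close>.
\<close>

definition stab_param :: "real \<Rightarrow> real^5 \<Rightarrow> aff2" where
  "stab_param c u =
     (vector [vector [u$1 - c * u$2, u$2], vector [c * (u$1 - c * u$2 - u$3), c * u$2 + u$3]],
      vector [u$4, c * u$4 + u$5])"

text \<open>These are entries of the conjugate of \<open>g\<close> by the inverse shear, with the
  lower left entry of its linear part omitted. The formula is linear on all of
  \<open>aff2\<close>.\<close>

definition stab_coord :: "real \<Rightarrow> aff2 \<Rightarrow> real^5" where
  "stab_coord c g = vec5 (fst g $ 1 $ 1 + c * fst g $ 1 $ 2) (fst g $ 1 $ 2)
     (fst g $ 2 $ 2 - c * fst g $ 1 $ 2) (snd g $ 1) (snd g $ 2 - c * snd g $ 1)"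

text \<open>The determinant of the linear part is \<open>u$1 * u$3\<close>, so this is
  invertibility.\<close>

definition stab_dom :: "(real^5) set" where
  "stab_dom = {u. u$1 \<noteq> 0 \<and> u$3 \<noteq> 0}"

text \<open>Composition of affine maps with upper triangular linear part. The constant
  \<open>c\<close> is absent because conjugation by the shear is a homomorphism.\<close>

definition stab_mult :: "real^5 \<Rightarrow> real^5 \<Rightarrow> real^5" where
  "stab_mult u v = vec5 (u$1 * v$1) (u$1 * v$2 + u$2 * v$3) (u$3 * v$3)
     (u$1 * v$4 + u$2 * v$5 + u$4) (u$3 * v$5 + u$5)"

definition stab_inv :: "real^5 \<Rightarrow> real^5" where
  "stab_inv u = vec5 (inverse (u$1)) (- (u$2 * inverse (u$1) * inverse (u$3))) (inverse (u$3))
     (- (u$4 * inverse (u$1)) + u$2 * u$5 * inverse (u$1) * inverse (u$3))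
     (- (u$5 * inverse (u$3)))"

section \<open>The group structure in coordinates\<close>

lemma stab_coord_param: "stab_coord c (stab_param c u) = u"
  by (simp add: stab_coord_def stab_param_def vec_eq_iff forall_5 algebra_simps)

lemma stab_param_mult:
  "stab_param c u \<otimes>\<^bsub>A2\<^esub> stab_param c v = stab_param c (stab_mult u v)"
  by (simp add: A2_def stab_param_def stab_mult_def vec_eq_iff forall_2 matrix_matrix_mult_def
      matrix_vector_mult_def sum_2 algebra_simps)

lemma stab_param_one: "stab_param c (vec5 1 0 1 0 0) = \<one>\<^bsub>A2\<^esub>"
  by (simp add: A2_def stab_param_def vec_eq_iff forall_2 mat_def)

lemma stab_param_carrier: "u \<in> stab_dom \<Longrightarrow> stab_param c u \<in> carrier A2"
proof -
  have "det (fst (stab_param c u)) = u$1 * u$3"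
    by (simp add: stab_param_def det_2 algebra_simps)
  then show "u \<in> stab_dom \<Longrightarrow> stab_param c u \<in> carrier A2"
    by (simp add: A2_def invertible_det_nz stab_dom_def)
qed

lemma stab_param_inv:
  assumes "u \<in> stab_dom"
  shows "inv\<^bsub>A2\<^esub> (stab_param c u) = stab_param c (stab_inv u)"
proof -
  interpret group A2 by (rule group_A2)
  have dom: "stab_inv u \<in> stab_dom"
    using assms by (simp add: stab_inv_def stab_dom_def)
  \<comment> \<open>In a group a left inverse is the inverse, so one product suffices;
    \<open>vec5 1 0 1 0 0\<close> parametrizes the identity.\<close>
  have "stab_mult (stab_inv u) u = vec5 1 0 1 0 0"
    using assms by (simp add: stab_inv_def stab_mult_def stab_dom_def vec_eq_iff forall_5 field_simps)
  then have "stab_param c (stab_inv u) \<otimes>\<^bsub>A2\<^esub> stab_param c u = \<one>\<^bsub>A2\<^esub>"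
    by (simp add: stab_param_mult stab_param_one)
  then show ?thesis
    using assms dom by (intro inv_equality) (auto simp: stab_param_carrier)
qed

lemma subgroup_stab: "subgroup (stab_param c ` stab_dom) A2"
proof
  show "stab_param c ` stab_dom \<subseteq> carrier A2"
    using stab_param_carrier by auto
next
  have "vec5 1 0 1 0 0 \<in> stab_dom"
    by (simp add: stab_dom_def)
  then show "\<one>\<^bsub>A2\<^esub> \<in> stab_param c ` stab_dom"
    by (metis image_eqI stab_param_one)
next
  fix g h assume "g \<in> stab_param c ` stab_dom" "h \<in> stab_param c ` stab_dom"
  then show "g \<otimes>\<^bsub>A2\<^esub> h \<in> stab_param c ` stab_dom"
    by (auto simp: stab_param_mult stab_mult_def stab_dom_def intro!: imageI)
next
  fix g assume "g \<in> stab_param c ` stab_dom"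
  then show "inv\<^bsub>A2\<^esub> g \<in> stab_param c ` stab_dom"
    by (auto simp: stab_param_inv) (auto simp: stab_inv_def stab_dom_def intro!: imageI)
qed

section \<open>Smoothness of the parametrization and of the group operations\<close>

lemma open_stab_dom: "open stab_dom"
  unfolding stab_dom_def
  by (intro open_Collect_conj open_Collect_neq continuous_intros)

lemma bounded_linear_stab_param: "bounded_linear (stab_param c)"
  by (intro linear_conv_bounded_linear[THEN iffD1] linearI)
     (simp_all add: stab_param_def vec_eq_iff forall_2 algebra_simps)

lemma bounded_linear_stab_coord: "bounded_linear (stab_coord c)"
  by (intro linear_conv_bounded_linear[THEN iffD1] linearI)
     (simp_all add: stab_coord_def vec_eq_iff forall_5 algebra_simps)

lemma smooth_on_stab_mult: "smooth_on (stab_dom \<times> stab_dom) (\<lambda>(u, v). stab_mult u v)"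
proof -
  have op: "open (stab_dom \<times> stab_dom)"
    by (simp add: open_Times open_stab_dom)
  have "smooth_on (stab_dom \<times> stab_dom) (\<lambda>w. fst w $ i)"
    "smooth_on (stab_dom \<times> stab_dom) (\<lambda>w. snd w $ i)" for i
    by (intro smooth_on_bounded_linear op bounded_linear_compose[OF bounded_linear_vec_nth]
        bounded_linear_fst bounded_linear_snd)+
  \<comment> \<open>Each component is a polynomial in the coordinate functions, which are
    linear.\<close>
  then have "\<forall>i. smooth_on (stab_dom \<times> stab_dom) (\<lambda>w. stab_mult (fst w) (snd w) $ i)"
    by (simp add: forall_5 stab_mult_def smooth_on_add smooth_on_mult op)
  then show ?thesis
    by (simp add: case_prod_beta smooth_on_vec op)
qed

lemma smooth_on_stab_inv: "smooth_on stab_dom stab_inv"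
proof -
  have nth: "smooth_on stab_dom (\<lambda>u. u $ i)" for i
    by (intro smooth_on_bounded_linear open_stab_dom bounded_linear_vec_nth)
  \<comment> \<open>The only denominators are \<open>u$1\<close> and \<open>u$3\<close>, which do
    not vanish on \<open>stab_dom\<close>.\<close>
  have "smooth_on stab_dom (\<lambda>u. inverse (u $ 1))" "smooth_on stab_dom (\<lambda>u. inverse (u $ 3))"
    by (rule smooth_on_inverse[OF open_stab_dom nth], simp add: stab_dom_def)+
  with nth have "\<forall>i. smooth_on stab_dom (\<lambda>u. stab_inv u $ i)"
    by (simp add: forall_5 stab_inv_def smooth_on_diff smooth_on_mult smooth_on_minus open_stab_dom)
  then show ?thesis
    by (simp add: smooth_on_vec open_stab_dom)
qed

lemma lie_subgroup_stab: "lie_subgroup_A2 TYPE(real^5) (stab_param c ` stab_dom)"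
proof -
  let ?H = "stab_param c ` stab_dom"
  let ?G = "A2\<lparr>carrier := ?H\<rparr>"
  interpret group A2 by (rule group_A2)
  \<comment> \<open>Inverses in the subgroup agree with those in \<open>A2\<close>, so the formula
    for \<open>stab_inv\<close> carries over.\<close>
  have "inv\<^bsub>?G\<^esub> stab_param c u = stab_param c (stab_inv u)" if "u \<in> stab_dom" for u
    using that m_inv_consistent[OF subgroup_stab] by (simp add: stab_param_inv)
  then have "smooth_on stab_dom (\<lambda>u. stab_coord c (inv\<^bsub>?G\<^esub> stab_param c u))"
    by (intro smooth_on_cong[OF open_stab_dom smooth_on_stab_inv]) (simp add: stab_coord_param)
  then have "lie_group ?G (top_of_set (carrier ?G)) {(stab_dom, stab_param c)}"
    using smooth_on_stab_mult
    by (intro lie_group_global_chart[where \<psi> = "stab_coord c"])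
       (auto simp: subgroup_imp_group subgroup_stab open_stab_dom stab_coord_param stab_param_mult
         linear_continuous_on bounded_linear_stab_param bounded_linear_stab_coord)
  \<comment> \<open>The parametrization is linear and equals its own derivative, so the immersion
    condition is its injectivity, which the left inverse \<open>stab_coord c\<close> gives.\<close>
  moreover have "frechet_derivative (stab_param c) (at u) = stab_param c" for u
    by (intro frechet_derivative_eq bounded_linear_imp_has_derivative bounded_linear_stab_param)
  moreover have "inj (stab_param c)"
    by (metis injI stab_coord_param)
  ultimately show ?thesis
    unfolding lie_subgroup_A2_def
    using subgroup_stab smooth_on_bounded_linear[OF bounded_linear_stab_param open_stab_dom]
    by (intro conjI exI[of _ "top_of_set (carrier ?G)"] exI[of _ "{(stab_dom, stab_param c)}"]) auto
qed

section \<open>Action of affine maps on constant line fields\<close>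

lemma frechet_derivative_aff: "frechet_derivative (aff g) (at p) = (*v) (fst g)"
proof (rule frechet_derivative_eq)
  have "((\<lambda>x. fst g *v x + snd g) has_derivative (*v) (fst g)) (at p)"
    by (intro has_derivative_add_const bounded_linear_imp_has_derivative
        matrix_vector_mul_bounded_linear)
  then show "(aff g has_derivative (*v) (fst g)) (at p)"
    by (simp add: aff_def[abs_def])
qed

lemma admits_stab: "admits UNIV (\<lambda>_. c) (stab_param c ` stab_dom)"
proof -
  have "(*v) (fst (stab_param c u)) ` line_field (\<lambda>_. c) p = line_field (\<lambda>_. c) q"
    if u: "u \<in> stab_dom" for u p q
  proof -
    \<comment> \<open>The line consists of the multiples of \<open>(1, c)\<close>, an eigenvector of
      the linear part with eigenvalue \<open>u$1\<close>.\<close>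
    have eig: "fst (stab_param c u) *v v = (u$1) *\<^sub>R v" if "v \<in> line_field (\<lambda>_. c) p" for v
      using that by (simp add: line_field_def stab_param_def vec_eq_iff forall_2
          matrix_vector_mult_def sum_2 algebra_simps)
    \<comment> \<open>Since \<open>u$1\<close> is nonzero, scaling by it maps the line onto itself,
      not just into it.\<close>
    have "w \<in> (*v) (fst (stab_param c u)) ` line_field (\<lambda>_. c) p"
      if w: "w \<in> line_field (\<lambda>_. c) q" for w
    proof (rule image_eqI)
      show "inverse (u$1) *\<^sub>R w \<in> line_field (\<lambda>_. c) p"
        using w by (simp add: line_field_def)
      from eig[OF this] u show "w = fst (stab_param c u) *v inverse (u$1) *\<^sub>R w"
        by (simp add: stab_dom_def)
    qed
    then show ?thesis
      using eig by (auto simp: line_field_def)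
  qed
  then show ?thesis
    by (auto simp: admits_def frechet_derivative_aff)
qed

lemma transformable_const: "transformable UNIV (\<lambda>_. c) UNIV (\<lambda>_. 0)"
proof -
  define g :: aff2 where "g = (vector [vector [1, 0], vector [- c, 1]], 0)"
  have g: "g \<in> carrier A2"
    by (simp add: g_def A2_def invertible_det_nz det_2)
  have gv: "fst g *v v = vector [v$1, v$2 - c * v$1]" for v
    by (simp add: g_def vec_eq_iff forall_2 matrix_vector_mult_def sum_2)
  \<comment> \<open>Both fields are constant, so the base points \<open>p\<close> and
    \<open>q\<close> may be arbitrary, and the same shear serves at every point.\<close>
  have "(*v) (fst g) ` line_field (\<lambda>_. c) p = line_field (\<lambda>_. 0) q" for p q
  proof (intro equalityI subsetI)
    fix w assume "w \<in> line_field (\<lambda>_. 0) q"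
    then show "w \<in> (*v) (fst g) ` line_field (\<lambda>_. c) p"
      \<comment> \<open>The shear fixes the first coordinate, so the preimage is the vector of slope
        \<open>c\<close> with that first coordinate.\<close>
      by (intro image_eqI[of _ _ "vector [w$1, c * w$1]"])
         (auto simp: gv line_field_def vec_eq_iff forall_2)
  qed (auto simp: gv line_field_def)
  then show ?thesis
    unfolding transformable_def frechet_derivative_aff using g by blast
qed

theorem theorem4p1:
  fixes c :: real
  shows "(\<exists>H. lie_subgroup_A2 TYPE(real^5) H \<and> admits UNIV (\<lambda>_. c) H) \<and>
         transformable UNIV (\<lambda>_. c) UNIV (\<lambda>_. 0)"
  using lie_subgroup_stab admits_stab transformable_const by blast

end
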